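(* Let $g$ be a $\mathbf{C}^n$-valued function, analytic in a neighbourhood of the origin of $\mathbf{C}^n$, with $g(0) = 0$, and consider the system $\dot{x} = g(x)$. Let $A = \frac{\partial g}{\partial x}(0)$ be the Jacobian matrix at the origin and let $\lambda_1,\dots,\lambda_n$ be its eigenvalues (counted with multiplicity). Suppose that $\det A \neq 0$ and that $A$ is diagonalizable. If the system possesses an analytic Lie symmetry of order $k$ in a neighbourhood of the origin, then for some $j \in \{1,\dots,n\}$ there exist non-negative integers $k_1,\dots,k_n$ such that $$\sum_{i=1}^n k_i\lambda_i = \lambda_j, \qquad \sum_{i=1}^n k_i = k .$$
   Context: A Lie symmetry of the system $\dot{x} = g(x)$ is a vector field $X_\phi = \sum_{i=1}^n \phi^i(x)\frac{\partial}{\partial x^i}$ with $[X_g, X_\phi] = X_g X_\phi - X_\phi X_g = 0$, where $X_g = \sum_{i=1}^n g^i(x)\frac{\partial}{\partial x^i}$. It is analytic if all components $\phi^i$ are analytic. An analytic vector field $X_\phi$ is of order $k$ (a non-negative integer) if the Taylor expansion at the origin of the coefficient vector $\phi = (\phi^1,\dots,\phi^n)$ starts from $k$-th order terms, i.e. all homogeneous parts of $\phi$ of degree less than $k$ vanish and the homogeneous part of degree $k$ is not identically zero. *)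

theory Defs
  imports "HOL-Analysis.Analysis" "HOL-Computational_Algebra.Polynomial"
begin

type_synonym 'n multi_index = "'n \<Rightarrow> nat"

definition mdegree :: "'n::finite multi_index \<Rightarrow> nat" where
  "mdegree \<alpha> = (\<Sum>i\<in>UNIV. \<alpha> i)"

definition mpow :: "complex ^ 'n \<Rightarrow> 'n::finite multi_index \<Rightarrow> complex" where
  "mpow x \<alpha> = (\<Prod>i\<in>UNIV. (x $ i) ^ \<alpha> i)"

lemma finite_mdegree: "finite {\<alpha> :: 'n::finite multi_index. mdegree \<alpha> = m}"
proof (rule finite_subset)
  show "{\<alpha> :: 'n multi_index. mdegree \<alpha> = m} \<subseteq> PiE UNIV (\<lambda>_. {..m})"
    by (auto simp: mdegree_def intro: member_le_sum)
  show "finite (PiE (UNIV :: 'n set) (\<lambda>_. {..m}))"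
    by (intro finite_PiE) auto
qed

text \<open>Multivariate power series are summed unconditionally over all multi-indices.
  The coefficient family is uniquely determined by the function near \<open>a\<close>;
  for \<open>a = 0\<close> it is the Taylor expansion at the origin.\<close>

definition has_power_series ::
    "(complex ^ 'n::finite \<Rightarrow> complex) \<Rightarrow> complex ^ 'n \<Rightarrow> ('n multi_index \<Rightarrow> complex) \<Rightarrow> bool" where
  "has_power_series f a c \<longleftrightarrow>
     (\<exists>r>0. \<forall>x\<in>ball a r. ((\<lambda>\<alpha>. c \<alpha> * mpow (x - a) \<alpha>) has_sum f x) UNIV)"

definition mv_analytic_on :: "(complex ^ 'n::finite \<Rightarrow> complex) \<Rightarrow> (complex ^ 'n) set \<Rightarrow> bool" where
  "mv_analytic_on f U \<longleftrightarrow> (\<forall>a\<in>U. \<exists>c. has_power_series f a c)"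

definition vec_analytic_on ::
    "(complex ^ 'n::finite \<Rightarrow> complex ^ 'n) \<Rightarrow> (complex ^ 'n) set \<Rightarrow> bool" where
  "vec_analytic_on v U \<longleftrightarrow> (\<forall>i. mv_analytic_on (\<lambda>x. v x $ i) U)"

definition partial_deriv ::
    "'n::finite \<Rightarrow> (complex ^ 'n \<Rightarrow> complex) \<Rightarrow> complex ^ 'n \<Rightarrow> complex" where
  "partial_deriv i f x = deriv (\<lambda>t. f (x + axis i t)) 0"

definition cjacobian ::
    "(complex ^ 'n::finite \<Rightarrow> complex ^ 'n) \<Rightarrow> complex ^ 'n \<Rightarrow> complex ^ 'n ^ 'n" where
  "cjacobian g x = (\<chi> i j. partial_deriv j (\<lambda>y. g y $ i) x)"

text \<open>The vector field with coefficient vector \<open>v\<close>, as a first-order differential operator.\<close>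

definition vector_field ::
    "(complex ^ 'n::finite \<Rightarrow> complex ^ 'n) \<Rightarrow> (complex ^ 'n \<Rightarrow> complex) \<Rightarrow> complex ^ 'n \<Rightarrow> complex" where
  "vector_field v f x = (\<Sum>i\<in>UNIV. v x $ i * partial_deriv i f x)"

text \<open>The commutator of operators is required to vanish on all analytic functions;
  the predicate is meant for open \<open>U\<close>, on which the partial derivatives depend only on
  the restrictions to \<open>U\<close>.\<close>

definition analytic_lie_symmetry_on ::
    "(complex ^ 'n::finite \<Rightarrow> complex ^ 'n) \<Rightarrow> (complex ^ 'n \<Rightarrow> complex ^ 'n) \<Rightarrow> (complex ^ 'n) set \<Rightarrow> bool" where
  "analytic_lie_symmetry_on g \<phi> U \<longleftrightarrow>
     vec_analytic_on \<phi> U \<and>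
     (\<forall>f. mv_analytic_on f U \<longrightarrow>
        (\<forall>x\<in>U. vector_field g (vector_field \<phi> f) x - vector_field \<phi> (vector_field g f) x = 0))"

definition homogeneous_part ::
    "('n \<Rightarrow> 'n::finite multi_index \<Rightarrow> complex) \<Rightarrow> nat \<Rightarrow> complex ^ 'n \<Rightarrow> complex ^ 'n" where
  "homogeneous_part c m x = (\<chi> i. \<Sum>\<alpha> | mdegree \<alpha> = m. c i \<alpha> * mpow x \<alpha>)"

definition has_order :: "(complex ^ 'n::finite \<Rightarrow> complex ^ 'n) \<Rightarrow> nat \<Rightarrow> bool" where
  "has_order \<phi> k \<longleftrightarrow>
     (\<exists>c. (\<forall>i. has_power_series (\<lambda>x. \<phi> x $ i) 0 (c i)) \<and>
          (\<forall>m<k. \<forall>x. homogeneous_part c m x = 0) \<and>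
          (\<exists>x. homogeneous_part c k x \<noteq> 0))"

definition diagonalizable :: "complex ^ 'n ^ 'n::finite \<Rightarrow> bool" where
  "diagonalizable A \<longleftrightarrow>
     (\<exists>P D :: complex ^ 'n ^ 'n. invertible P \<and> (\<forall>i j. i \<noteq> j \<longrightarrow> D $ i $ j = 0) \<and> A = P ** D ** matrix_inv P)"

definition charpoly :: "complex ^ 'n ^ 'n::finite \<Rightarrow> complex poly" where
  "charpoly A = det (mat [:0, 1:] - map_matrix (\<lambda>a. [:a:]) A)"

text \<open>\<open>ev\<close> enumerates the eigenvalues of \<open>A\<close> with algebraic multiplicity.\<close>

definition eigenvalues_of :: "complex ^ 'n ^ 'n::finite \<Rightarrow> ('n \<Rightarrow> complex) \<Rightarrow> bool" where
  "eigenvalues_of A ev \<longleftrightarrow> charpoly A = (\<Prod>i\<in>UNIV. [:- ev i, 1:])"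

end

(* Evaluating the commutator on the coordinate functions gives Dphi g = Dg phi.  Replace x by t x
   and divide by t^k: as t tends to 0, the rescaled components of g and phi converge uniformly on
   complex discs to their lowest homogeneous parts, hence so do their partial derivatives, and the
   limit is the homological equation DH(x) A x = A H(x) for the homogeneous part H of degree k.
   Let l be a left eigenvector of A with eigenvalue d and l H not identically 0.  Along a solution
   x(s) of x' = A x the function l H(x(s)) is then a multiple of exp(d s); but x(s) is a combination
   of the functions exp(d_j s), d_j the eigenvalues, so l H(x(s)) is a combination of exponentials
   whose rates are sums of k eigenvalues.  Since exponentials are linearly independent, d is
   such a sum. *)
theory Submission
  imports Defs "HOL-Complex_Analysis.Cauchy_Integral_Formula"
begin

section \<open>Homogeneous parts and bounds for power series on polydiscs\<close>

text \<open>Scalar counterpart of \<open>homogeneous_part\<close>, so that limits and derivatives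
  can be treated for one component of \<open>g\<close> or \<open>\<phi>\<close> at a time.\<close>

definition homog :: "('n::finite multi_index \<Rightarrow> complex) \<Rightarrow> nat \<Rightarrow> complex ^ 'n \<Rightarrow> complex" where
  "homog c m x = (\<Sum>\<alpha> | mdegree \<alpha> = m. c \<alpha> * mpow x \<alpha>)"

lemma homogeneous_part_nth: "homogeneous_part c m x $ i = homog (c i) m x"
  by (simp add: homogeneous_part_def homog_def)

lemma mpow_scale: "mpow (t *s x) \<alpha> = t ^ mdegree \<alpha> * mpow x \<alpha>"
  by (simp add: mpow_def mdegree_def power_mult_distrib prod.distrib power_sum)

lemma homog_scale: "homog c m (t *s x) = t ^ m * homog c m x"
  by (auto simp: homog_def mpow_scale sum_distrib_left intro!: sum.cong)

lemma norm_mpow_le: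
  assumes "\<And>i. norm (x $ i) \<le> R"
  shows "norm (mpow x \<alpha>) \<le> R ^ mdegree \<alpha>"
  unfolding mpow_def mdegree_def power_sum prod_norm[symmetric] norm_power
  by (intro prod_mono conjI power_mono assms) auto

lemma norm_vec_le_sum: "norm x \<le> (\<Sum>i\<in>UNIV. norm (x $ i))" for x :: "complex ^ 'n::finite"
  unfolding norm_vec_def by (rule L2_set_le_sum) simp

text \<open>Convergence at the single point with all coordinates \<open>\<rho>\<close> is absolute,
  since unconditional and absolute summability agree over the complex numbers. This gives one
  majorant for the whole closed polydisc of radius \<open>\<rho>\<close>.\<close>

lemma has_power_series_polydisc:
  fixes f :: "complex ^ 'n::finite \<Rightarrow> complex"
  assumes "has_power_series f 0 c"
  obtains \<rho> where "\<rho> > 0" "(\<lambda>\<alpha>. norm (c \<alpha>) * \<rho> ^ mdegree \<alpha>) summable_on UNIV"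
    "\<And>x. (\<And>i. norm (x $ i) \<le> \<rho>) \<Longrightarrow> ((\<lambda>\<alpha>. c \<alpha> * mpow x \<alpha>) has_sum f x) UNIV"
proof -
  obtain r where r: "r > 0" "\<And>x. x \<in> ball 0 r \<Longrightarrow> ((\<lambda>\<alpha>. c \<alpha> * mpow x \<alpha>) has_sum f x) UNIV"
    using assms unfolding has_power_series_def by auto
  \<comment> \<open>With this radius the polydisc lies in the ball: the norm of \<open>x\<close> is
    at most \<open>CARD('n)\<close> times \<open>\<rho>\<close>, which is less than
    \<open>r\<close>.\<close>
  define \<rho> where "\<rho> = r / (real CARD('n) + 1)"
  have \<rho>: "\<rho> > 0" using r by (simp add: \<rho>_def add_pos_pos)
  have hs: "((\<lambda>\<alpha>. c \<alpha> * mpow x \<alpha>) has_sum f x) UNIV" if "\<And>i. norm (x $ i) \<le> \<rho>" for x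
  proof (rule r(2))
    have "norm x \<le> (\<Sum>i\<in>(UNIV::'n set). norm (x $ i))" by (rule norm_vec_le_sum)
    also have "\<dots> \<le> (\<Sum>i\<in>(UNIV::'n set). \<rho>)" by (intro sum_mono that)
    also have "\<dots> < r" using r by (simp add: \<rho>_def field_simps)
    finally show "x \<in> ball 0 r" by simp
  qed
  have "((\<lambda>\<alpha>. c \<alpha> * mpow (\<chi> i. of_real \<rho>) \<alpha>) has_sum f (\<chi> i. of_real \<rho>)) UNIV"
    by (rule hs) (use \<rho> in simp)
  then have "(\<lambda>\<alpha>. norm (c \<alpha> * mpow (\<chi> i. of_real \<rho>) \<alpha>)) summable_on UNIV"
    by (rule summable_on_iff_abs_summable_on_complex[THEN iffD1, OF has_sum_imp_summable])
  moreover have "norm (c \<alpha> * mpow (\<chi> i. of_real \<rho>) \<alpha>) = norm (c \<alpha>) * \<rho> ^ mdegree \<alpha>" for \<alpha>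
    using \<rho> by (simp add: mpow_def mdegree_def norm_mult norm_power power_sum[symmetric])
  ultimately show thesis using that[OF \<rho> _ hs] by simp
qed

text \<open>Subtracting the degree \<open>k\<close> part leaves only degrees at least
  \<open>Suc k\<close>. As \<open>\<sigma>\<close> is at most 1, on the polydisc shrunk by
  \<open>\<sigma>\<close> each such term is at most \<open>\<sigma> ^ Suc k\<close> times its
  majorant.\<close>

lemma homog_remainder_bound:
  fixes f :: "complex ^ 'n::finite \<Rightarrow> complex"
  assumes sm: "(\<lambda>\<alpha>. norm (c \<alpha>) * \<rho> ^ mdegree \<alpha>) summable_on UNIV" and \<rho>: "\<rho> > 0"
    and hs: "((\<lambda>\<alpha>. c \<alpha> * mpow x \<alpha>) has_sum f x) UNIV"
    and low: "\<And>m. m < k \<Longrightarrow> homog c m x = 0"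
    and \<sigma>: "0 \<le> \<sigma>" "\<sigma> \<le> 1" and x: "\<And>i. norm (x $ i) \<le> \<sigma> * \<rho>"
  shows "norm (f x - homog c k x) \<le> (\<Sum>\<^sub>\<infinity>\<alpha>. norm (c \<alpha>) * \<rho> ^ mdegree \<alpha>) * \<sigma> ^ Suc k"
proof -
  let ?M = "\<lambda>\<alpha>. norm (c \<alpha>) * \<rho> ^ mdegree \<alpha>"
  let ?B = "{\<alpha> :: 'n multi_index. mdegree \<alpha> \<le> k}"
  have un: "?B = (\<Union>m\<in>{..k}. {\<alpha>. mdegree \<alpha> = m})" by auto
  have fin: "finite ?B" unfolding un by (intro finite_UN_I finite_mdegree) auto
  have "(\<Sum>\<alpha>\<in>?B. c \<alpha> * mpow x \<alpha>) = (\<Sum>m\<le>k. homog c m x)"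
    unfolding un homog_def by (rule sum.UNION_disjoint) (auto intro: finite_mdegree)
  also have "\<dots> = (\<Sum>m\<in>{k}. homog c m x)"
    by (rule sum.mono_neutral_right) (auto intro: low)
  finally have "((\<lambda>\<alpha>. c \<alpha> * mpow x \<alpha>) has_sum homog c k x) ?B"
    using has_sum_finite[OF fin, of "\<lambda>\<alpha>. c \<alpha> * mpow x \<alpha>"] by simp
  from has_sum_Diff[OF hs this]
  have d: "((\<lambda>\<alpha>. c \<alpha> * mpow x \<alpha>) has_sum (f x - homog c k x)) (UNIV - ?B)" by simp
  have smC: "(\<lambda>\<alpha>. ?M \<alpha> * \<sigma> ^ Suc k) summable_on UNIV"
    by (intro summable_on_cmult_left sm)
  have le: "norm (c \<alpha> * mpow x \<alpha>) \<le> ?M \<alpha> * \<sigma> ^ Suc k" if "\<alpha> \<in> UNIV - ?B" for \<alpha>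
  proof -
    have "norm (mpow x \<alpha>) \<le> (\<sigma> * \<rho>) ^ mdegree \<alpha>" by (intro norm_mpow_le x)
    also have "\<dots> \<le> \<sigma> ^ Suc k * \<rho> ^ mdegree \<alpha>"
      unfolding power_mult_distrib using that \<sigma> \<rho>
      by (intro mult_right_mono power_decreasing) auto
    finally have "norm (c \<alpha>) * norm (mpow x \<alpha>) \<le> norm (c \<alpha>) * (\<sigma> ^ Suc k * \<rho> ^ mdegree \<alpha>)"
      by (rule mult_left_mono) simp
    then show ?thesis by (simp add: norm_mult mult_ac)
  qed
  have "norm (f x - homog c k x) \<le> (\<Sum>\<^sub>\<infinity>\<alpha>\<in>UNIV - ?B. ?M \<alpha> * \<sigma> ^ Suc k)"
    using d has_sum_infsum[OF summable_on_subset_banach[OF smC]] le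
    by (rule norm_infsum_le) auto
  also have "\<dots> \<le> (\<Sum>\<^sub>\<infinity>\<alpha>. ?M \<alpha> * \<sigma> ^ Suc k)"
    using summable_on_subset_banach[OF smC] smC \<rho> \<sigma> by (intro infsum_mono_neutral) auto
  also have "\<dots> = (\<Sum>\<^sub>\<infinity>\<alpha>. ?M \<alpha>) * \<sigma> ^ Suc k"
    by (rule infsum_cmult_left') 
  finally show ?thesis .
qed

section \<open>Derivatives of monomials and homogeneous polynomials\<close>

lemma has_field_derivative_mpow:
  assumes "\<And>i. ((\<lambda>s. x s $ i) has_field_derivative x' $ i) (at s)"
  shows "((\<lambda>s. mpow (x s) \<alpha>) has_field_derivative
    (\<Sum>i\<in>UNIV. x' $ i * (of_nat (\<alpha> i) * x s $ i ^ (\<alpha> i - 1) * (\<Prod>j\<in>UNIV - {i}. x s $ j ^ \<alpha> j)))) (at s)"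
  unfolding mpow_def
  by (rule DERIV_cong[OF has_field_derivative_prod[OF DERIV_power[OF assms]]])
     (auto intro!: sum.cong simp: mult_ac)

lemma axis_zero [simp]: "axis j (0::complex) = 0"
  by (simp add: vec_eq_iff axis_def)

lemma has_field_derivative_axis:
  "((\<lambda>s. (x + axis j s) $ i) has_field_derivative axis j 1 $ i) (at s)"
  by (cases "i = j") (auto simp: axis_def intro!: derivative_eq_intros)

lemma has_field_derivative_mpow_axis:
  "((\<lambda>s. mpow (x + axis j s) \<alpha>) has_field_derivative
    of_nat (\<alpha> j) * x $ j ^ (\<alpha> j - 1) * (\<Prod>i\<in>UNIV - {j}. x $ i ^ \<alpha> i)) (at 0)"
proof -
  have "axis j (1::complex) $ i * z = (if i = j then z else 0)" for i z
    by (simp add: axis_def)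
  then show ?thesis
    using has_field_derivative_mpow[OF has_field_derivative_axis, of x j \<alpha> 0] by simp
qed

lemma partial_deriv_mpow:
  "partial_deriv j (\<lambda>x. mpow x \<alpha>) x = of_nat (\<alpha> j) * x $ j ^ (\<alpha> j - 1) * (\<Prod>i\<in>UNIV - {j}. x $ i ^ \<alpha> i)"
  unfolding partial_deriv_def by (rule DERIV_imp_deriv[OF has_field_derivative_mpow_axis])

lemma partial_deriv_homog:
  "partial_deriv j (homog c k) x = (\<Sum>\<alpha> | mdegree \<alpha> = k. c \<alpha> * partial_deriv j (\<lambda>x. mpow x \<alpha>) x)"
  \<comment> \<open>The derivatives of monomials are made explicit first, so that unfolding
    \<open>partial_deriv_def\<close> afterwards affects only the left-hand side.\<close>
  unfolding partial_deriv_mpow unfolding partial_deriv_def homog_def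
  by (intro DERIV_imp_deriv DERIV_sum DERIV_cmult has_field_derivative_mpow_axis)

text \<open>Chain rule along a curve, for use on solutions of the linear system and on lines through
  the origin.\<close>

lemma has_field_derivative_homog:
  assumes "\<And>i. ((\<lambda>s. x s $ i) has_field_derivative x' $ i) (at s)"
  shows "((\<lambda>s. homog c k (x s)) has_field_derivative
    (\<Sum>i\<in>UNIV. x' $ i * partial_deriv i (homog c k) (x s))) (at s)"
proof -
  have "((\<lambda>s. homog c k (x s)) has_field_derivative
     (\<Sum>\<alpha> | mdegree \<alpha> = k. c \<alpha> * (\<Sum>i\<in>UNIV. x' $ i * partial_deriv i (\<lambda>x. mpow x \<alpha>) (x s)))) (at s)"
    unfolding homog_def partial_deriv_mpow
    by (intro DERIV_sum DERIV_cmult has_field_derivative_mpow assms)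
  moreover have "(\<Sum>\<alpha> | mdegree \<alpha> = k. c \<alpha> * (\<Sum>i\<in>UNIV. x' $ i * partial_deriv i (\<lambda>x. mpow x \<alpha>) (x s)))
     = (\<Sum>i\<in>UNIV. x' $ i * partial_deriv i (homog c k) (x s))"
    unfolding partial_deriv_homog sum_distrib_left
    by (subst sum.swap) (simp add: mult_ac)
  ultimately show ?thesis by simp
qed

section \<open>Complex derivatives of power series along coordinate axes\<close>

text \<open>\<open>partial_deriv\<close> is informative only where the underlying derivative exists.
  By the Weierstrass M-test the finite partial sums, polynomials in \<open>s\<close>, converge
  uniformly on a disc, so the limit is holomorphic inside it.\<close>

lemma power_series_differentiable_axis:
  fixes f :: "complex ^ 'n::finite \<Rightarrow> complex"
  assumes sm: "(\<lambda>\<alpha>. norm (c \<alpha>) * \<rho> ^ mdegree \<alpha>) summable_on UNIV"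
    and hs: "\<And>x. (\<And>i. norm (x $ i) \<le> \<rho>) \<Longrightarrow> ((\<lambda>\<alpha>. c \<alpha> * mpow x \<alpha>) has_sum f x) UNIV"
    and x: "\<And>i. norm (x $ i) < \<rho>"
  shows "(\<lambda>s. f (x + axis j s)) field_differentiable at 0"
proof -
  \<comment> \<open>Room left in coordinate \<open>j\<close>: for \<open>s\<close> of norm at most
    \<open>\<delta>\<close> the shifted point stays in the closed polydisc.\<close>
  define \<delta> where "\<delta> = \<rho> - norm (x $ j)"
  have \<delta>: "\<delta> > 0" using x by (simp add: \<delta>_def)
  have b: "norm ((x + axis j s) $ i) \<le> \<rho>" if "s \<in> cball 0 \<delta>" for s i
    using that x[of i] norm_triangle_ineq[of "x $ j" s] by (auto simp: axis_def \<delta>_def)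
  have "uniform_limit (cball 0 \<delta>) (\<lambda>X s. \<Sum>\<alpha>\<in>X. c \<alpha> * mpow (x + axis j s) \<alpha>)
      (\<lambda>s. f (x + axis j s)) (finite_subsets_at_top UNIV)"
  proof (rule Weierstrass_m_test_general'[OF _ _ sm])
    show "norm (c \<alpha> * mpow (x + axis j s) \<alpha>) \<le> norm (c \<alpha>) * \<rho> ^ mdegree \<alpha>" if "s \<in> cball 0 \<delta>" for \<alpha> s
      unfolding norm_mult by (intro mult_left_mono norm_mpow_le b that) auto
  qed (intro hs b)
  moreover have "(\<lambda>s. mpow (x + axis j s) \<alpha>) field_differentiable at s" for \<alpha> s
    using has_field_derivative_mpow[OF has_field_derivative_axis]
    unfolding field_differentiable_def by blast
  then have "(\<lambda>s. mpow (x + axis j s) \<alpha>) holomorphic_on S" for \<alpha> S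
    by (auto intro: holomorphic_onI field_differentiable_at_within)
  then have "(\<lambda>s. \<Sum>\<alpha>\<in>X. c \<alpha> * mpow (x + axis j s) \<alpha>) holomorphic_on S" for X S
    by (intro holomorphic_on_sum holomorphic_on_mult holomorphic_on_const)
  ultimately have "(\<lambda>s. f (x + axis j s)) holomorphic_on ball 0 \<delta>"
    by (rule_tac holomorphic_uniform_limit[where F = "finite_subsets_at_top UNIV"])
       (auto intro!: always_eventually holomorphic_on_imp_continuous_on)
  then show ?thesis using \<delta> by (auto intro: holomorphic_on_imp_differentiable_at)
qed

text \<open>Moving \<open>s\<close> by \<open>h\<close> moves the scaled point by
  \<open>t * h\<close> along the same axis, which produces the factor \<open>t\<close>.\<close>

lemma has_field_derivative_along_axis:
  assumes "(\<lambda>u. f (t *s (x + axis j s) + axis j u)) field_differentiable at 0"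
  shows "((\<lambda>s. f (t *s (x + axis j s))) has_field_derivative
     t * partial_deriv j f (t *s (x + axis j s))) (at s)"
proof -
  let ?z = "t *s (x + axis j s)"
  \<comment> \<open>The point \<open>t * (s - s)\<close> is 0, written as the value at
    \<open>s\<close> of the inner function of the chain rule.\<close>
  have D: "((\<lambda>u. f (?z + axis j u)) has_field_derivative partial_deriv j f ?z) (at (t * (s - s)))"
    using assms by (simp add: partial_deriv_def field_differentiable_derivI)
  have "((\<lambda>s'. t * (s' - s)) has_field_derivative t) (at s)"
    by (auto intro!: derivative_eq_intros)
  note chain = DERIV_chain2[OF D this]
  have "?z + axis j (t * (s' - s)) = t *s (x + axis j s')" for s'
    by (simp add: vec_eq_iff axis_def algebra_simps)
  from chain[unfolded this] show ?thesis
    by (rule DERIV_cong) (rule mult.commute)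
qed

section \<open>Rescaling to the lowest homogeneous part\<close>

text \<open>By homogeneity the remainder bound divided by \<open>t ^ k\<close> is of size
  \<open>norm t\<close>, uniformly for shifts \<open>s\<close> in the unit disc along axis
  \<open>j\<close>. Uniform convergence of holomorphic functions passes to their derivatives, which
  gives the second limit. Keeping the factor \<open>t\<close> beside \<open>t ^ k\<close>, instead
  of an exponent \<open>k - 1\<close>, covers \<open>k = 0\<close>.\<close>

lemma scaling_limit:
  fixes f :: "complex ^ 'n::finite \<Rightarrow> complex"
  assumes hps: "has_power_series f 0 c" and low: "\<And>m x. m < k \<Longrightarrow> homog c m x = 0"
  shows "((\<lambda>t. f (t *s x) / t ^ k) \<longlongrightarrow> homog c k x) (at 0)"
    and "((\<lambda>t. t * partial_deriv j f (t *s x) / t ^ k) \<longlongrightarrow> partial_deriv j (homog c k) x) (at 0)"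
proof -
  obtain \<rho> where \<rho>: "\<rho> > 0" and sm: "(\<lambda>\<alpha>. norm (c \<alpha>) * \<rho> ^ mdegree \<alpha>) summable_on UNIV"
    and hs: "\<And>x. (\<And>i. norm (x $ i) \<le> \<rho>) \<Longrightarrow> ((\<lambda>\<alpha>. c \<alpha> * mpow x \<alpha>) has_sum f x) UNIV"
    using has_power_series_polydisc[OF hps] by metis
  define M where "M = (\<Sum>\<^sub>\<infinity>\<alpha>. norm (c \<alpha>) * \<rho> ^ mdegree \<alpha>)"
  \<comment> \<open>\<open>norm t * R\<close> bounds all coordinates of
    \<open>t *s (x + axis j s)\<close> for \<open>s\<close> in the closed unit disc.\<close>
  define R where "R = norm x + 1"
  \<comment> \<open>Chosen so that \<open>M * \<sigma> ^ Suc k\<close> equals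
    \<open>B * norm t * norm (t ^ k)\<close> for
    \<open>\<sigma> = norm t * R / \<rho>\<close>.\<close>
  define B where "B = M * (R / \<rho>) ^ Suc k"
  have R: "R > 0" by (simp add: R_def add_nonneg_pos)
  have comp: "norm ((t *s (x + axis j s)) $ i) \<le> norm t * R" if "s \<in> cball 0 1" for t s i
  proof -
    have "norm ((x + axis j s) $ i) \<le> norm (x $ i) + norm (axis j s $ i)"
      by (simp add: norm_triangle_ineq)
    also have "\<dots> \<le> R"
      unfolding R_def using that
      by (intro add_mono Finite_Cartesian_Product.norm_nth_le) (auto simp: axis_def)
    finally show ?thesis by (simp only: vector_smult_component norm_mult) (simp add: mult_left_mono)
  qed
  have small: "\<forall>\<^sub>F t::complex in at 0. t \<noteq> 0 \<and> norm t * R < \<rho>"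
  proof -
    have "((\<lambda>t::complex. norm t * R) \<longlongrightarrow> 0) (at 0)" by (auto intro!: tendsto_eq_intros)
    from order_tendstoD(2)[OF this \<rho>] show ?thesis
      by (auto simp: eventually_conj_iff eventually_at_filter)
  qed
  have ul: "uniform_limit (cball 0 1) (\<lambda>t s. f (t *s (x + axis j s)) / t ^ k)
      (\<lambda>s. homog c k (x + axis j s)) (at 0)"
  proof (rule uniform_limitI)
    fix e :: real assume e: "e > 0"
    have "((\<lambda>t::complex. B * norm t) \<longlongrightarrow> 0) (at 0)" by (auto intro!: tendsto_eq_intros)
    from order_tendstoD(2)[OF this e] small
    show "\<forall>\<^sub>F t in at 0. \<forall>s\<in>cball 0 1.
        dist (f (t *s (x + axis j s)) / t ^ k) (homog c k (x + axis j s)) < e"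
    proof eventually_elim
      case (elim t)
      show ?case
      proof
        fix s :: complex assume s: "s \<in> cball 0 1"
        let ?y = "x + axis j s" and ?\<sigma> = "norm t * R / \<rho>"
        have nt: "norm (t ^ k) > 0" using elim by (simp add: norm_power)
        have hsy: "((\<lambda>\<alpha>. c \<alpha> * mpow (t *s ?y) \<alpha>) has_sum f (t *s ?y)) UNIV"
        proof (rule hs)
          show "norm ((t *s ?y) $ i) \<le> \<rho>" for i using comp[OF s, of t i] elim by linarith
        qed
        have "norm (f (t *s ?y) - homog c k (t *s ?y)) \<le> M * ?\<sigma> ^ Suc k"
          unfolding M_def
        proof (rule homog_remainder_bound[where f = f and x = "t *s ?y", OF sm \<rho> hsy low])
          show "norm ((t *s ?y) $ i) \<le> ?\<sigma> * \<rho>" for i using comp[OF s, of t i] \<rho> by simp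
        qed (use elim \<rho> R in auto)
        also have "\<dots> = B * norm t * norm (t ^ k)"
          by (simp add: B_def norm_power power_divide power_mult_distrib)
        finally have *: "norm (f (t *s ?y) - t ^ k * homog c k ?y) \<le> B * norm t * norm (t ^ k)"
          by (simp only: homog_scale)
        have "f (t *s ?y) / t ^ k - homog c k ?y = (f (t *s ?y) - t ^ k * homog c k ?y) / t ^ k"
          using elim by (simp add: field_simps)
        then have "dist (f (t *s ?y) / t ^ k) (homog c k ?y)
            = norm (f (t *s ?y) - t ^ k * homog c k ?y) / norm (t ^ k)"
          by (simp add: dist_norm norm_divide)
        also have "\<dots> \<le> B * norm t" using * nt by (simp add: pos_divide_le_eq)
        also have "\<dots> < e" using elim by simp
        finally show "dist (f (t *s ?y) / t ^ k) (homog c k ?y) < e" .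
      qed
    qed
  qed
  from tendsto_uniform_limitI[OF this, of 0]
  show "((\<lambda>t. f (t *s x) / t ^ k) \<longlongrightarrow> homog c k x) (at 0)" by simp
  have "\<forall>\<^sub>F t in at 0. continuous_on (cball 0 1) (\<lambda>s. f (t *s (x + axis j s)) / t ^ k) \<and>
      (\<forall>w\<in>ball 0 1. ((\<lambda>s. f (t *s (x + axis j s)) / t ^ k) has_field_derivative
        t * partial_deriv j f (t *s (x + axis j w)) / t ^ k) (at w))"
    using small
  proof eventually_elim
    case (elim t)
    have "((\<lambda>s. f (t *s (x + axis j s)) / t ^ k) has_field_derivative
        t * partial_deriv j f (t *s (x + axis j w)) / t ^ k) (at w)" if w: "w \<in> cball 0 1" for w
    proof (intro DERIV_cdivide has_field_derivative_along_axis power_series_differentiable_axis[OF sm hs])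
      show "norm ((t *s (x + axis j w)) $ i) < \<rho>" for i
        using comp[OF w, of t i] elim by linarith
    qed
    then show ?case
      by (auto intro!: continuous_at_imp_continuous_on DERIV_isCont)
  qed
  from has_complex_derivative_uniform_limit[OF this ul] obtain g' where
    "\<And>w. w \<in> ball 0 1 \<Longrightarrow> ((\<lambda>s. homog c k (x + axis j s)) has_field_derivative g' w) (at w) \<and>
      ((\<lambda>t. t * partial_deriv j f (t *s (x + axis j w)) / t ^ k) \<longlongrightarrow> g' w) (at 0)"
    by auto
  \<comment> \<open>At the centre of the disc the shift vanishes, and \<open>g' 0\<close> is the
    partial derivative of the homogeneous part at \<open>x\<close>.\<close>
  from this[of 0] show "((\<lambda>t. t * partial_deriv j f (t *s x) / t ^ k) \<longlongrightarrow> partial_deriv j (homog c k) x) (at 0)"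
    by (auto simp: partial_deriv_def dest: DERIV_imp_deriv)
qed

section \<open>The commutator on coordinate functions, and Taylor terms of degree 0 and 1\<close>

lemma partial_deriv_coordinate:
  "partial_deriv j (\<lambda>y. y $ i) x = (if i = j then 1 else 0)"
  unfolding partial_deriv_def using has_field_derivative_axis[of x j i 0]
  by (auto simp: axis_def dest: DERIV_imp_deriv)

lemma vector_field_coordinate: "vector_field v (\<lambda>y. y $ i) = (\<lambda>x. v x $ i)"
  by (rule ext) (simp add: vector_field_def partial_deriv_coordinate if_distrib cong: if_cong)

text \<open>The expansion at \<open>a\<close> is \<open>a $ i + (x - a) $ i\<close>: only the zero
  multi-index and the unit multi-index at \<open>i\<close> can contribute. It holds everywhere, so
  radius 1 serves.\<close>

lemma mv_analytic_on_coordinate: "mv_analytic_on (\<lambda>y. y $ i) V"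
  unfolding mv_analytic_on_def has_power_series_def
proof (intro ballI exI conjI)
  fix a x :: "complex ^ 'a"
  let ?e = "\<lambda>j. if j = i then 1 else 0 :: nat"
  let ?c = "\<lambda>\<alpha>. if \<alpha> = (\<lambda>_. 0) then a $ i else if \<alpha> = ?e then 1 else 0"
  have ne: "(\<lambda>_. 0) \<noteq> ?e" by (auto simp: fun_eq_iff)
  have "mpow y ?e = y $ i" for y :: "complex ^ 'a"
    by (simp add: mpow_def if_distrib[where f = "\<lambda>n. _ ^ n"] cong: if_cong)
  moreover have "mpow y (\<lambda>_. 0) = 1" for y :: "complex ^ 'a"
    by (simp add: mpow_def)
  ultimately show "((\<lambda>\<alpha>. ?c \<alpha> * mpow (x - a) \<alpha>) has_sum x $ i) UNIV"
    using ne by (intro has_sum_finite_neutralI[where B = "{\<lambda>_. 0, ?e}"]) auto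
qed (rule zero_less_one)

text \<open>A vector field sends the \<open>i\<close>-th coordinate function to its own
  \<open>i\<close>-th coefficient, so testing the commutator there gives the bracket in
  components.\<close>

lemma lie_symmetry_coordinates:
  assumes "analytic_lie_symmetry_on g \<phi> V" "x \<in> V"
  shows "(\<Sum>j\<in>UNIV. g x $ j * partial_deriv j (\<lambda>y. \<phi> y $ i) x) =
    (\<Sum>j\<in>UNIV. \<phi> x $ j * partial_deriv j (\<lambda>y. g y $ i) x)"
proof -
  have "vector_field g (vector_field \<phi> (\<lambda>y. y $ i)) x -
      vector_field \<phi> (vector_field g (\<lambda>y. y $ i)) x = 0"
    using assms mv_analytic_on_coordinate[of i V]
    unfolding analytic_lie_symmetry_on_def by blast
  then show ?thesis unfolding vector_field_coordinate by (simp add: vector_field_def)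
qed

text \<open>At the origin the rescaled function for \<open>k = 0\<close> is constant, so the scaling
  limit is its value.\<close>

lemma homog_zero_degree:
  assumes "has_power_series f 0 c"
  shows "homog c 0 x = f 0"
proof -
  have "((\<lambda>t::complex. f 0) \<longlongrightarrow> homog c 0 0) (at 0)"
    using scaling_limit(1)[OF assms, of 0 0] by simp
  then have "homog c 0 0 = f 0" by (simp add: tendsto_const_iff)
  \<comment> \<open>Scaling by 0, with \<open>0 ^ 0 = 1\<close>, shows that the degree 0 part takes
    the same value at \<open>x\<close> and at the origin.\<close>
  then show ?thesis using homog_scale[of c 0 0 x] by simp
qed

text \<open>Euler's relation in degree 1: differentiate
  \<open>homog c 1 (s *s x) = s * homog c 1 x\<close> at \<open>s = 0\<close>.\<close>

lemma homog_one_eq: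
  "homog c 1 x = (\<Sum>i\<in>UNIV. x $ i * partial_deriv i (homog c 1) 0)"
proof -
  have "((\<lambda>s. homog c 1 (s *s x)) has_field_derivative
      (\<Sum>i\<in>UNIV. x $ i * partial_deriv i (homog c 1) (0 *s x))) (at 0)"
    by (intro has_field_derivative_homog) (auto intro!: derivative_eq_intros)
  moreover have "((\<lambda>s. homog c 1 (s *s x)) has_field_derivative homog c 1 x) (at 0)"
    by (auto simp: homog_scale intro!: derivative_eq_intros)
  ultimately show ?thesis using DERIV_unique by fastforce
qed

lemma partial_deriv_homog_one:
  "partial_deriv j (homog c 1) x = partial_deriv j (homog c 1) 0"
proof -
  have "homog c 1 (x + axis j s) = homog c 1 x + s * partial_deriv j (homog c 1) 0" for s
    unfolding homog_one_eq[of c "x + axis j s"] homog_one_eq[of c x]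
    by (simp add: distrib_right sum.distrib axis_def if_distrib[where f = "\<lambda>z. z * _"] cong: if_cong)
  then show ?thesis
    unfolding partial_deriv_def[of j "homog c 1" x]
    by (intro DERIV_imp_deriv) (auto intro!: derivative_eq_intros)
qed

text \<open>Links linear Taylor coefficients with the Jacobian: at the origin the rescaled
  derivative for \<open>k = 1\<close> is constant in nonzero \<open>t\<close>. The condition
  \<open>f 0 = 0\<close> makes the degree 0 part vanish, as the scaling limit requires.\<close>

lemma partial_deriv_zero_eq_homog:
  assumes "has_power_series f 0 c" "f 0 = 0"
  shows "partial_deriv j (homog c 1) 0 = partial_deriv j f 0"
proof -
  have "((\<lambda>t. t * partial_deriv j f (t *s 0) / t ^ 1) \<longlongrightarrow> partial_deriv j (homog c 1) 0) (at 0)"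
    by (rule scaling_limit(2)[OF assms(1)]) (use homog_zero_degree[OF assms(1)] assms(2) in auto)
  moreover have "\<forall>\<^sub>F t in at (0::complex). t * partial_deriv j f (t *s 0) / t ^ 1 = partial_deriv j f 0"
    by (auto simp: eventually_at_filter)
  ultimately have "((\<lambda>t::complex. partial_deriv j f 0) \<longlongrightarrow> partial_deriv j (homog c 1) 0) (at 0)"
    by (rule Lim_transform_eventually)
  then show ?thesis by (simp add: tendsto_const_iff)
qed

section \<open>The homological equation\<close>

text \<open>With \<open>g\<close> rescaled in degree 1 and \<open>\<phi>\<close> in degree
  \<open>k\<close>, both sides of the bracket identity at \<open>t *s x\<close> are divided by the
  same power \<open>t ^ k\<close>. The limit keeps only the linear part of \<open>g\<close> and the
  degree \<open>k\<close> part of \<open>\<phi>\<close>.\<close>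

lemma homological_equation:
  fixes g \<phi> :: "complex ^ 'n::finite \<Rightarrow> complex ^ 'n"
  assumes V: "open V" "0 \<in> V" and sym: "analytic_lie_symmetry_on g \<phi> V"
    and g0: "g 0 = 0" and a: "\<And>i. has_power_series (\<lambda>x. g x $ i) 0 (a i)"
    and c: "\<And>i. has_power_series (\<lambda>x. \<phi> x $ i) 0 (c i)"
    and low: "\<And>m x i. m < k \<Longrightarrow> homog (c i) m x = 0"
  shows "(\<Sum>j\<in>UNIV. (cjacobian g 0 *v x) $ j * partial_deriv j (homog (c i) k) x) =
    (\<Sum>j\<in>UNIV. cjacobian g 0 $ i $ j * homog (c j) k x)"
proof -
  have A: "partial_deriv j (homog (a i) 1) y = cjacobian g 0 $ i $ j" for i j y
    unfolding partial_deriv_homog_one[of j "a i" y]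
    using partial_deriv_zero_eq_homog[OF a, of i j] g0 by (simp add: cjacobian_def)
  have lin: "homog (a i) 1 x = (cjacobian g 0 *v x) $ i" for i
    unfolding homog_one_eq A by (simp add: matrix_vector_mult_def mult.commute)
  have low1: "homog (a i) m y = 0" if "m < 1" for i m y
    using that homog_zero_degree[OF a, of i y] g0 by simp
  have lim: "((\<lambda>t. \<Sum>j\<in>UNIV. (g (t *s x) $ j / t ^ 1) *
        (t * partial_deriv j (\<lambda>y. \<phi> y $ i) (t *s x) / t ^ k)) \<longlongrightarrow>
      (\<Sum>j\<in>UNIV. homog (a j) 1 x * partial_deriv j (homog (c i) k) x)) (at 0)"
    by (intro tendsto_sum tendsto_mult scaling_limit[OF a low1] scaling_limit[OF c low])
  have lim': "((\<lambda>t. \<Sum>j\<in>UNIV. (\<phi> (t *s x) $ j / t ^ k) *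
        (t * partial_deriv j (\<lambda>y. g y $ i) (t *s x) / t ^ 1)) \<longlongrightarrow>
      (\<Sum>j\<in>UNIV. homog (c j) k x * partial_deriv j (homog (a i) 1) x)) (at 0)"
    by (intro tendsto_sum tendsto_mult scaling_limit[OF a low1] scaling_limit[OF c low])
  \<comment> \<open>Openness of \<open>V\<close> makes the symmetry condition available at
    \<open>t *s x\<close> for all small \<open>t\<close>.\<close>
  have "((\<lambda>t. t *s x) \<longlongrightarrow> 0 *s x) (at (0::complex))"
    by (rule vec_tendstoI) (auto intro!: tendsto_eq_intros)
  then have "\<forall>\<^sub>F t in at (0::complex). t *s x \<in> V"
    using V by (auto dest: topological_tendstoD)
  moreover have "\<forall>\<^sub>F t in at (0::complex). t \<noteq> 0" by (auto simp: eventually_at_filter)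
  ultimately have "\<forall>\<^sub>F t in at 0.
      (\<Sum>j\<in>UNIV. (g (t *s x) $ j / t ^ 1) * (t * partial_deriv j (\<lambda>y. \<phi> y $ i) (t *s x) / t ^ k)) =
      (\<Sum>j\<in>UNIV. (\<phi> (t *s x) $ j / t ^ k) * (t * partial_deriv j (\<lambda>y. g y $ i) (t *s x) / t ^ 1))"
  proof eventually_elim
    case (elim t)
    show ?case
      using lie_symmetry_coordinates[OF sym elim(1), of i] elim(2)
      by (simp add: sum_divide_distrib[symmetric])
  qed
  from Lim_transform_eventually[OF lim this] lim'
  have "(\<Sum>j\<in>UNIV. homog (a j) 1 x * partial_deriv j (homog (c i) k) x) =
      (\<Sum>j\<in>UNIV. homog (c j) k x * partial_deriv j (homog (a i) 1) x)"
    by (rule tendsto_unique[OF trivial_limit_at])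
  then show ?thesis unfolding lin A by (simp add: mult.commute)
qed

section \<open>Exponential sums and the expansion of monomials along solutions\<close>

text \<open>Linear independence of exponentials in a form that tolerates repeated rates, since
  different monomials may produce the same rate. The induction over \<open>I\<close> keeps
  \<open>F\<close> general because its step passes to a multiple of \<open>F\<close>.\<close>

lemma exp_sum_eigenfunction_zero:
  fixes F :: "complex \<Rightarrow> complex"
  assumes "finite I"
    and "\<And>s. F s = (\<Sum>a\<in>I. q a * exp (\<mu> a * s))"
    and "\<And>s. (F has_field_derivative d * F s) (at s)"
    and "\<And>a. a \<in> I \<Longrightarrow> \<mu> a \<noteq> d"
  shows "F s = 0"
  using assms
proof (induction I arbitrary: q F s rule: finite_induct)
  case (insert b I)
  \<comment> \<open>Applying \<open>d/ds - \<mu> b\<close> removes the term of \<open>b\<close> and only rescales \<open>F\<close>.\<close>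
  let ?G = "\<lambda>s. (d - \<mu> b) * F s"
  have "?G s = (\<Sum>a\<in>I. (q a * (\<mu> a - \<mu> b)) * exp (\<mu> a * s))" for s
  proof -
    have F: "F = (\<lambda>s. \<Sum>a\<in>insert b I. q a * exp (\<mu> a * s))"
      using insert.prems(1) by blast
    have "(F has_field_derivative (\<Sum>a\<in>insert b I. q a * (\<mu> a * exp (\<mu> a * s)))) (at s)"
      unfolding F by (intro DERIV_sum) (auto intro!: derivative_eq_intros)
    then have dF: "d * F s = (\<Sum>a\<in>insert b I. q a * (\<mu> a * exp (\<mu> a * s)))"
      using insert.prems(2) DERIV_unique by blast
    have "?G s = d * F s - \<mu> b * F s" by (rule left_diff_distrib)
    also have "\<dots> = (\<Sum>a\<in>insert b I. q a * (\<mu> a * exp (\<mu> a * s))) -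
        \<mu> b * (\<Sum>a\<in>insert b I. q a * exp (\<mu> a * s))"
      unfolding dF by (subst insert.prems(1)) (rule refl)
    also have "\<dots> = (\<Sum>a\<in>insert b I. (q a * (\<mu> a - \<mu> b)) * exp (\<mu> a * s))"
      by (simp only: sum_distrib_left sum_subtractf[symmetric]) (simp add: algebra_simps)
    finally have "?G s = (\<Sum>a\<in>insert b I. (q a * (\<mu> a - \<mu> b)) * exp (\<mu> a * s))" .
    then show ?thesis using insert.hyps by simp
  qed
  moreover have "(?G has_field_derivative d * ?G s) (at s)" for s
    by (rule DERIV_cong[OF DERIV_cmult[OF insert.prems(2)]]) simp
  ultimately have "?G s = 0"
    by (rule insert.IH) (use insert.prems(3) in auto)
  \<comment> \<open>The factor \<open>d - \<mu> b\<close> is nonzero and can be cancelled.\<close>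
  then show ?case using insert.prems(3) by auto
qed simp

text \<open>One index for each linear factor of the monomial \<open>x\<^sup>\<alpha>\<close>: substituting a linear map for \<open>x\<close>
  expands the monomial over all functions on \<open>factor_index \<alpha>\<close>, so that resonances come out as
  sums of exactly \<open>mdegree \<alpha>\<close> eigenvalues.\<close>

definition factor_index :: "'n multi_index \<Rightarrow> ('n \<times> nat) set" where
  "factor_index \<alpha> = Sigma UNIV (\<lambda>i. {..<\<alpha> i})"

lemma finite_factor_index: "finite (factor_index (\<alpha> :: 'n::finite multi_index))"
  by (simp add: factor_index_def)

lemma card_factor_index: "card (factor_index (\<alpha> :: 'n::finite multi_index)) = mdegree \<alpha>"
  by (simp add: factor_index_def mdegree_def)

text \<open>Distributivity: \<open>h\<close> selects the summand \<open>h p\<close> in each linear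
  factor \<open>p\<close>, and \<open>fst p\<close> is the variable of which \<open>p\<close> is a
  copy. Multiplying the selected exponentials adds their rates.\<close>

lemma mpow_exp_expansion:
  fixes x :: "complex \<Rightarrow> complex ^ 'n::finite" and d :: "'n \<Rightarrow> complex"
  assumes "\<And>i. x s $ i = (\<Sum>j\<in>UNIV. B i j * exp (d j * s))"
  shows "mpow (x s) \<alpha> = (\<Sum>h\<in>factor_index \<alpha> \<rightarrow>\<^sub>E UNIV.
    (\<Prod>p\<in>factor_index \<alpha>. B (fst p) (h p)) * exp ((\<Sum>p\<in>factor_index \<alpha>. d (h p)) * s))"
proof -
  have "mpow (x s) \<alpha> = (\<Prod>p\<in>factor_index \<alpha>. x s $ fst p)"
    using prod.Sigma[of UNIV "\<lambda>i. {..<\<alpha> i}" "\<lambda>i _. x s $ i"]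
    by (simp add: mpow_def factor_index_def split_def)
  also have "\<dots> = (\<Sum>h\<in>factor_index \<alpha> \<rightarrow>\<^sub>E UNIV. \<Prod>p\<in>factor_index \<alpha>. B (fst p) (h p) * exp (d (h p) * s))"
    unfolding assms by (rule prod_sum_PiE) (auto simp: finite_factor_index)
  finally show ?thesis
    by (simp add: prod.distrib exp_sum finite_factor_index sum_distrib_right)
qed

section \<open>Diagonal entries as roots of the characteristic polynomial\<close>

text \<open>Evaluation at \<open>z\<close> respects sums and products, hence the Leibniz expansion
  of the determinant.\<close>

lemma poly_charpoly: "poly (charpoly A) z = det (mat z - A)"
  unfolding charpoly_def det_def
  by (auto simp: poly_sum poly_prod mat_def map_matrix_def intro!: sum.cong prod.cong)

text \<open>For \<open>z\<close> a diagonal entry, \<open>mat z - D\<close> is singular, and so is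
  the similar matrix \<open>mat z - A\<close>. Thus \<open>z\<close> is a root of the characteristic
  polynomial, whose factorization lists the roots as values of \<open>ev\<close>.\<close>

lemma diagonal_entry_eigenvalue:
  fixes A P D :: "complex ^ 'n ^ 'n::finite"
  assumes "eigenvalues_of A ev" "invertible P" "\<And>i j. i \<noteq> j \<Longrightarrow> D $ i $ j = 0" "A ** P = P ** D"
  shows "\<exists>i. D $ j $ j = ev i"
proof -
  let ?z = "D $ j $ j"
  have "(mat ?z - A) ** P = P ** (mat ?z - D)"
  proof -
    have "mat ?z ** P = P ** mat ?z"
      by (simp add: vec_eq_iff matrix_matrix_mult_def mat_def if_distrib[where f = "\<lambda>z. z * _"]
          if_distrib[where f = "\<lambda>z. _ * z"] cong: if_cong)
    then show ?thesis
      using assms(4)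
      by (simp add: vec_eq_iff matrix_matrix_mult_def algebra_simps sum_subtractf)
  qed
  then have "det (mat ?z - A) * det P = det P * det (mat ?z - D)"
    by (metis det_mul)
  moreover have "det (mat ?z - D) = 0"
    by (subst det_diagonal) (auto simp: mat_def assms(3))
  ultimately have "poly (charpoly A) ?z = 0"
    using assms(2) by (simp add: poly_charpoly invertible_det_nz)
  then show ?thesis
    using assms(1) by (auto simp: eigenvalues_of_def poly_prod)
qed

section \<open>Resonance from the homological equation\<close>

text \<open>\<open>Q\<close> is the inverse of \<open>P\<close>, so its rows are left eigenvectors
  of \<open>A\<close>. In the conclusion \<open>h\<close> assigns a diagonal entry to each of the
  \<open>k\<close> linear factors of a monomial.\<close>

lemma resonance_of_linear_symmetry:
  fixes A P D :: "complex ^ 'n ^ 'n::finite"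
  assumes inv: "P ** Q = mat 1" "Q ** P = mat 1"
    and diag: "\<And>i j. i \<noteq> j \<Longrightarrow> D $ i $ j = 0" and A: "A = P ** D ** Q"
    and heq: "\<And>x i. (\<Sum>j\<in>UNIV. (A *v x) $ j * partial_deriv j (homog (c i) k) x) =
      (\<Sum>j\<in>UNIV. A $ i $ j * homog (c j) k x)"
    and nz: "homog (c i0) k x0 \<noteq> 0"
  shows "\<exists>i (\<alpha> :: 'n multi_index) h. mdegree \<alpha> = k \<and> D $ i $ i = (\<Sum>p\<in>factor_index \<alpha>. D $ h p $ h p)"
proof -
  let ?d = "\<lambda>j. D $ j $ j"
  define H where "H x = (\<chi> i. homog (c i) k x)" for x
  have D: "D *v v = (\<chi> i. ?d i * v $ i)" for v
  proof (simp add: vec_eq_iff matrix_vector_mult_def, intro allI)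
    show "(\<Sum>j\<in>UNIV. D $ i $ j * v $ j) = ?d i * v $ i" for i
      by (subst sum.remove[of _ i]) (auto simp: diag intro!: sum.neutral)
  qed
  have "Q *v H x0 \<noteq> 0"
  proof
    assume "Q *v H x0 = 0"
    then have "P *v (Q *v H x0) = 0" by simp
    then have "H x0 = 0" using inv by (simp add: matrix_vector_mul_assoc)
    then show False using nz by (simp add: H_def vec_eq_iff)
  qed
  \<comment> \<open>Row \<open>i\<close> of \<open>Q\<close> is the left eigenvector to be paired
    with \<open>H\<close>; the pairing is nonzero at \<open>x0\<close>.\<close>
  then obtain i where i: "(Q *v H x0) $ i \<noteq> 0" by (auto simp: vec_eq_iff)
  define y where "y = Q *v x0"
  \<comment> \<open>The solution of the linear system with matrix \<open>A\<close> that starts at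
    \<open>x0\<close>; \<open>y\<close> holds the coordinates of \<open>x0\<close> in the
    eigenbasis.\<close>
  define x where "x s = P *v (\<chi> j. y $ j * exp (?d j * s))" for s
  have x_exp: "x s $ l = (\<Sum>j\<in>UNIV. (P $ l $ j * y $ j) * exp (?d j * s))" for s l
    by (simp add: x_def matrix_vector_mult_def mult.assoc)
  have x0: "x 0 = x0"
    using inv by (simp add: x_def y_def matrix_vector_mul_assoc)
  have x': "((\<lambda>s. x s $ l) has_field_derivative (A *v x s) $ l) (at s)" for s l
  proof -
    have "A *v x s = P *v (D *v ((Q ** P) *v (\<chi> j. y $ j * exp (?d j * s))))"
      by (simp add: A x_def matrix_vector_mul_assoc matrix_mul_assoc)
    also have "\<dots> = P *v (\<chi> j. ?d j * (y $ j * exp (?d j * s)))"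
      by (simp add: inv D)
    finally have "(A *v x s) $ l = (\<Sum>j\<in>UNIV. P $ l $ j * (?d j * (y $ j * exp (?d j * s))))"
      by (simp add: matrix_vector_mult_def)
    then show ?thesis
      unfolding x_exp by (auto intro!: derivative_eq_intros sum.cong)
  qed
  define F where "F s = (Q *v H (x s)) $ i" for s
  have F_sum: "F s = (\<Sum>l\<in>UNIV. Q $ i $ l * homog (c l) k (x s))" for s
    by (simp add: F_def H_def matrix_vector_mult_def)
  have F': "(F has_field_derivative ?d i * F s) (at s)" for s
  proof -
    have "(F has_field_derivative (\<Sum>l\<in>UNIV. Q $ i $ l *
        (\<Sum>j\<in>UNIV. (A *v x s) $ j * partial_deriv j (homog (c l) k) (x s)))) (at s)"
      unfolding F_sum[abs_def] by (intro DERIV_sum DERIV_cmult has_field_derivative_homog x')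
    \<comment> \<open>The homological equation replaces the derivative of \<open>H\<close> along the
      solution by \<open>A *v H (x s)\<close>; the left eigenvector then extracts the factor
      \<open>?d i\<close>.\<close>
    moreover have "(\<Sum>l\<in>UNIV. Q $ i $ l *
        (\<Sum>j\<in>UNIV. (A *v x s) $ j * partial_deriv j (homog (c l) k) (x s))) = (Q *v (A *v H (x s))) $ i"
      unfolding heq by (simp add: matrix_vector_mult_def H_def)
    moreover have "Q *v (A *v H (x s)) = D *v (Q *v H (x s))"
      by (simp add: A matrix_vector_mul_assoc matrix_mul_assoc inv)
    ultimately show ?thesis by (simp add: D F_def)
  qed
  \<comment> \<open>One term for each monomial of degree \<open>k\<close> and each selection of
    exponentials in its factors; \<open>q\<close> collects the coefficient and \<open>\<mu>\<close>
    the rate.\<close>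
  define I where "I = (SIGMA \<alpha>:{\<alpha> :: 'n multi_index. mdegree \<alpha> = k}. factor_index \<alpha> \<rightarrow>\<^sub>E (UNIV :: 'n set))"
  define q where "q = (\<lambda>(\<alpha>, h). (\<Sum>l\<in>UNIV. Q $ i $ l * c l \<alpha>) *
    (\<Prod>p\<in>factor_index \<alpha>. P $ fst p $ h p * y $ h p))"
  define \<mu> where "\<mu> = (\<lambda>(\<alpha> :: 'n multi_index, h). \<Sum>p\<in>factor_index \<alpha>. ?d (h p))"
  have finI: "finite I"
    unfolding I_def by (intro finite_SigmaI finite_mdegree finite_PiE finite_factor_index) auto
  have "F s = (\<Sum>a\<in>I. q a * exp (\<mu> a * s))" for s
  proof -
    have "F s = (\<Sum>\<alpha> | mdegree \<alpha> = k. (\<Sum>l\<in>UNIV. Q $ i $ l * c l \<alpha>) * mpow (x s) \<alpha>)"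
      unfolding F_sum homog_def sum_distrib_left sum_distrib_right mult.assoc by (rule sum.swap)
    also have "\<dots> = (\<Sum>\<alpha> | mdegree \<alpha> = k. \<Sum>h\<in>factor_index \<alpha> \<rightarrow>\<^sub>E UNIV.
        q (\<alpha>, h) * exp (\<mu> (\<alpha>, h) * s))"
      unfolding mpow_exp_expansion[where x = x and B = "\<lambda>l j. P $ l $ j * y $ j" and d = ?d, OF x_exp] q_def \<mu>_def
      by (simp add: sum_distrib_left mult.assoc)
    also have "\<dots> = (\<Sum>a\<in>I. q a * exp (\<mu> a * s))"
      unfolding I_def
      by (subst sum.Sigma) (auto simp: finite_mdegree finite_factor_index intro!: finite_PiE)
    finally show ?thesis .
  qed
  \<comment> \<open>If every rate differed from \<open>?d i\<close>, then \<open>F 0\<close> would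
    vanish, but it is the nonzero entry chosen with \<open>i\<close>.\<close>
  then have "\<exists>a\<in>I. \<mu> a = ?d i"
    using exp_sum_eigenfunction_zero[of I F q \<mu> "?d i" 0] finI F' i by (auto simp: F_def x0)
  then obtain \<alpha> h where "(\<alpha>, h) \<in> I" "\<mu> (\<alpha>, h) = ?d i" by auto
  then show ?thesis
    by (intro exI[of _ i] exI[of _ \<alpha>] exI[of _ h]) (simp add: I_def \<mu>_def)
qed

section \<open>Regrouping the resonance by the enumerated eigenvalues\<close>

theorem lemma1:
  fixes g \<phi> :: "complex ^ 'n::finite \<Rightarrow> complex ^ 'n"
    and U V :: "(complex ^ 'n) set"
    and A :: "complex ^ 'n ^ 'n"
    and ev :: "'n \<Rightarrow> complex"
    and k :: nat
  assumes "open U" and "0 \<in> U" and "vec_analytic_on g U"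
    and "g 0 = 0"
    and "A = cjacobian g 0"
    and "eigenvalues_of A ev"
    and "det A \<noteq> 0"
    and "diagonalizable A"
    and "open V" and "0 \<in> V" and "V \<subseteq> U"
    and "analytic_lie_symmetry_on g \<phi> V"
    and "has_order \<phi> k"
  shows "\<exists>j. \<exists>ks :: 'n \<Rightarrow> nat.
           (\<Sum>i\<in>UNIV. of_nat (ks i) * ev i) = ev j \<and> (\<Sum>i\<in>UNIV. ks i) = k"
proof -
  have "\<forall>i. \<exists>c. has_power_series (\<lambda>x. g x $ i) 0 c"
    using assms(2,3) by (simp add: vec_analytic_on_def mv_analytic_on_def)
  from choice[OF this] obtain a where a: "\<And>i. has_power_series (\<lambda>x. g x $ i) 0 (a i)"
    by blast
  obtain c x0 where c: "\<And>i. has_power_series (\<lambda>x. \<phi> x $ i) 0 (c i)"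
    and low: "\<And>m x. m < k \<Longrightarrow> homogeneous_part c m x = 0" and x0: "homogeneous_part c k x0 \<noteq> 0"
    using assms(13) unfolding has_order_def by blast
  obtain i0 where i0: "homog (c i0) k x0 \<noteq> 0"
    using x0 by (auto simp: vec_eq_iff homogeneous_part_nth)
  have low': "homog (c i) m x = 0" if "m < k" for i m x
    using low[OF that, of x] by (simp flip: homogeneous_part_nth)
  obtain P D :: "complex ^ 'n ^ 'n" where P: "invertible P" and D: "\<And>i j. i \<noteq> j \<Longrightarrow> D $ i $ j = 0"
    and A: "A = P ** D ** matrix_inv P"
    using assms(8) unfolding diagonalizable_def by blast
  \<comment> \<open>\<open>matrix_inv\<close> is defined by choice, so both inverse laws come from
    the existence of an inverse of \<open>P\<close>.\<close>
  have inv: "P ** matrix_inv P = mat 1" "matrix_inv P ** P = mat 1"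
    using someI_ex[OF P[unfolded invertible_def]] by (simp_all add: matrix_inv_def)
  have AP: "A ** P = P ** D"
    by (simp add: A inv flip: matrix_mul_assoc)
  have "\<forall>j. \<exists>i. D $ j $ j = ev i"
    using diagonal_entry_eigenvalue[OF assms(6) P D AP] by blast
  from choice[OF this] obtain \<tau> where \<tau>: "\<And>j. D $ j $ j = ev (\<tau> j)" by blast
  have heq: "(\<Sum>j\<in>UNIV. (A *v x) $ j * partial_deriv j (homog (c i) k) x) =
      (\<Sum>j\<in>UNIV. A $ i $ j * homog (c j) k x)" for x i
    unfolding assms(5) by (rule homological_equation[OF assms(9,10,12,4) a c low'])
  have "\<exists>i (\<alpha> :: 'n multi_index) h. mdegree \<alpha> = k \<and> D $ i $ i = (\<Sum>p\<in>factor_index \<alpha>. D $ h p $ h p)"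
    by (rule resonance_of_linear_symmetry[OF inv D A heq i0])
  then obtain i and \<alpha> :: "'n multi_index" and h where \<alpha>: "mdegree \<alpha> = k"
    and res: "D $ i $ i = (\<Sum>p\<in>factor_index \<alpha>. D $ h p $ h p)"
    by blast
  \<comment> \<open>The multiplicity of \<open>ev j\<close> counts the linear factors whose selected
    diagonal entry is labelled \<open>j\<close> by \<open>\<tau>\<close>. These classes partition
    the \<open>k\<close> factors, so both required sums follow by regrouping.\<close>
  define ks where "ks j = card {p \<in> factor_index \<alpha>. \<tau> (h p) = j}" for j
  have fin: "finite (factor_index \<alpha>)" by (rule finite_factor_index)
  have "(\<Sum>j\<in>UNIV. of_nat (ks j) * ev j) =
      (\<Sum>j\<in>UNIV. \<Sum>p | p \<in> factor_index \<alpha> \<and> \<tau> (h p) = j. ev (\<tau> (h p)))"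
    unfolding ks_def by (intro sum.cong refl) simp
  also have "\<dots> = (\<Sum>p\<in>factor_index \<alpha>. ev (\<tau> (h p)))"
    by (rule sum.group) (auto simp: fin)
  also have "\<dots> = ev (\<tau> i)" using res by (simp add: \<tau>)
  finally have "(\<Sum>j\<in>UNIV. of_nat (ks j) * ev j) = ev (\<tau> i)" .
  moreover have "(\<Sum>j\<in>UNIV. ks j) = k"
    using sum.group[OF fin finite_class.finite_UNIV, of "\<lambda>p. \<tau> (h p)" "\<lambda>_. 1::nat"]
    by (simp add: ks_def card_factor_index \<alpha>)
  ultimately show ?thesis by blast
qed

end
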